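(* Let $\mathsf{W}$ be a weak equivalence set on a finite lattice $P$. Then (1) $\mathrm{AF}(\mathsf{W})$ is a lattice with meet and join inherited from $\mathrm{Tr}(P)$; and (2) in particular, $\mathrm{AF}(\mathsf{W})$ is the interval sublattice $[\mathsf{AF}_{min},\mathsf{AF}_{max}]=\{T\in\mathrm{Tr}(P)\mid \mathsf{AF}_{min}\subseteq T\subseteq\mathsf{AF}_{max}\}$.
   Context: A finite lattice $P$ is regarded as a category whose objects are the elements of $P$, with a unique arrow $a\to b$ whenever $a\le b$. A wide subcategory is one containing all objects; a subcategory $D$ of $P$ is decomposable if whenever $f,g$ are composable morphisms of $P$ with $g\circ f\in D$, then $f\in D$ and $g\in D$. Wide subcategories are identified with their collections of morphisms, and $\subseteq$ is containment of morphisms. A transfer system on $P$ is a partial order $R$ on the set $P$ such that $xRy$ implies $x\le y$, and $xRy$, $z\le y$ imply $(x\wedge z)Rz$; equivalently, a wide subcategory of $P$ closed under pullbacks (the pullbacks of $x\to y$ are the arrows $x\wedge z\to z$ for $z\le y$). $\mathrm{Tr}(P)$ is the lattice of transfer systems ordered by inclusion: the meet is intersection, and the join is the smallest transfer system containing the union. For arrows $i\colon a\to b$ and $p\colon x\to y$, $i$ has the left lifting property with respect to $p$ (and $p$ the right lifting property with respect to $i$) if every commutative square from $i$ to $p$ has a diagonal lift $b\to x$. A weak factorization system on $P$ is a pair $(L,R)$ of classes of morphisms such that every morphism factors as $p\circ i$ with $i\in L$, $p\in R$; $L$ is the class of all morphisms with the left lifting property against all of $R$; and $R$ is the class of all morphisms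 with the right lifting property against all of $L$. A model structure on $P$ consists of two weak factorization systems $(\mathsf{AC},\mathsf{F})$ and $(\mathsf{C},\mathsf{AF})$ with $\mathsf{AC}\subseteq\mathsf{C}$ such that $\mathsf{W}:=\mathsf{AF}\circ\mathsf{AC}=\{p\circ i: i\in\mathsf{AC},\,p\in\mathsf{AF}\}$ (the weak equivalences) satisfies the two-out-of-three axiom; $\mathsf{AF}$ are the acyclic fibrations and $\mathsf{AC}$ the acyclic cofibrations. A wide decomposable subcategory $\mathsf{W}$ of $P$ is a weak equivalence set if there is a model structure on $P$ with weak equivalences $\mathsf{W}$. $\mathrm{AF}(\mathsf{W})$ is the set of transfer systems contained in $\mathsf{W}$ that form the acyclic fibrations of a model structure on $P$ with weak equivalences $\mathsf{W}$. $\mathsf{AF}_{min}$ is the meet, and $\mathsf{AF}_{max}$ the join, in $\mathrm{Tr}(P)$ of all elements of $\mathrm{AF}(\mathsf{W})$. *)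

theory Defs
  imports "HOL-Algebra.Complete_Lattice"
begin

text \<open>
  A finite lattice is a type of sort \<open>{finite, lattice}\<close>. The arrow \<open>a \<rightarrow> b\<close> is the pair \<open>(a, b)\<close>
  with \<open>a \<le> b\<close>, so classes of morphisms are relations, and the class \<open>{p \<circ> i. i \<in> A, p \<in> B}\<close> is
  \<open>A O B\<close>: relational composition is written in diagrammatic order.
\<close>

definition arrows :: "'a::order rel" where
  "arrows = {(a, b). a \<le> b}"

definition wide_subcategory :: "'a::order rel \<Rightarrow> bool" where
  "wide_subcategory D \<longleftrightarrow> D \<subseteq> arrows \<and> refl D \<and> trans D"

definition decomposable :: "'a::order rel \<Rightarrow> bool" where
  "decomposable D \<longleftrightarrow>
    (\<forall>a b c. (a, b) \<in> arrows \<and> (b, c) \<in> arrows \<and> (a, c) \<in> D \<longrightarrow> (a, b) \<in> D \<and> (b, c) \<in> D)"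

text \<open>
  HOL-Algebra reuses the names \<open>inf\<close> and \<open>sup\<close>, so the meet of the type class is written
  \<open>Lattices.inf\<close>.
\<close>

definition transfer_system :: "'a::{finite, lattice} rel \<Rightarrow> bool" where
  "transfer_system R \<longleftrightarrow>
    partial_order_on UNIV R \<and> R \<subseteq> arrows \<and>
    (\<forall>x y z. (x, y) \<in> R \<and> z \<le> y \<longrightarrow> (Lattices.inf x z, z) \<in> R)"

definition Tr :: "'a::{finite, lattice} rel set" where
  "Tr = {R. transfer_system R}"

text \<open>A set of relations ordered by inclusion, as an ordered structure of HOL-Algebra.\<close>

definition incl_order :: "'a rel set \<Rightarrow> 'a rel gorder" where
  "incl_order \<A> = \<lparr>carrier = \<A>, eq = (=), le = (\<subseteq>)\<rparr>"

text \<open>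
  In a poset every square commutes and both triangles of a diagonal commute: a square from
  \<open>a \<rightarrow> b\<close> to \<open>x \<rightarrow> y\<close> is a pair of arrows \<open>a \<rightarrow> x\<close>, \<open>b \<rightarrow> y\<close>, and a lift is an arrow \<open>b \<rightarrow> x\<close>.
\<close>

definition has_lifting :: "'a::order \<times> 'a \<Rightarrow> 'a \<times> 'a \<Rightarrow> bool" where
  "has_lifting i p \<longleftrightarrow>
    ((fst i, fst p) \<in> arrows \<and> (snd i, snd p) \<in> arrows \<longrightarrow> (snd i, fst p) \<in> arrows)"

definition llp :: "'a::order rel \<Rightarrow> 'a rel" where
  "llp R = {i \<in> arrows. \<forall>p\<in>R. has_lifting i p}"

definition rlp :: "'a::order rel \<Rightarrow> 'a rel" where
  "rlp L = {p \<in> arrows. \<forall>i\<in>L. has_lifting i p}"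

definition weak_factorization_system :: "'a::order rel \<Rightarrow> 'a rel \<Rightarrow> bool" where
  "weak_factorization_system L R \<longleftrightarrow> arrows \<subseteq> L O R \<and> L = llp R \<and> R = rlp L"

definition two_out_of_three :: "'a::order rel \<Rightarrow> bool" where
  "two_out_of_three W \<longleftrightarrow>
    (\<forall>a b c. (a, b) \<in> arrows \<and> (b, c) \<in> arrows \<longrightarrow>
      ((a, b) \<in> W \<and> (b, c) \<in> W \<longrightarrow> (a, c) \<in> W) \<and>
      ((a, b) \<in> W \<and> (a, c) \<in> W \<longrightarrow> (b, c) \<in> W) \<and>
      ((b, c) \<in> W \<and> (a, c) \<in> W \<longrightarrow> (a, b) \<in> W))"

definition model_structure :: "'a::order rel \<Rightarrow> 'a rel \<Rightarrow> 'a rel \<Rightarrow> 'a rel \<Rightarrow> bool" where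
  "model_structure AC F C AF \<longleftrightarrow>
    weak_factorization_system AC F \<and> weak_factorization_system C AF \<and> AC \<subseteq> C \<and>
    two_out_of_three (AC O AF)"

definition weak_equivalence_set :: "'a::{finite, lattice} rel \<Rightarrow> bool" where
  "weak_equivalence_set W \<longleftrightarrow>
    wide_subcategory W \<and> decomposable W \<and>
    (\<exists>AC F C AF. model_structure AC F C AF \<and> W = AC O AF)"

definition AF_set :: "'a::{finite, lattice} rel \<Rightarrow> 'a rel set" where
  "AF_set W = {T \<in> Tr. T \<subseteq> W \<and> (\<exists>AC F C. model_structure AC F C T \<and> W = AC O T)}"

definition AF_min :: "'a::{finite, lattice} rel \<Rightarrow> 'a rel" where
  "AF_min W = \<Sqinter>\<^bsub>incl_order Tr\<^esub> (AF_set W)"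

definition AF_max :: "'a::{finite, lattice} rel \<Rightarrow> 'a rel" where
  "AF_max W = \<Squnion>\<^bsub>incl_order Tr\<^esub> (AF_set W)"

text \<open>
  \<open>inf\<close> and \<open>sup\<close> of HOL-Algebra choose a greatest lower and a least upper bound. These exist for
  all sets of transfer systems: the meet is the intersection (within \<open>arrows\<close>), and the join is the
  smallest transfer system containing the union.
\<close>

lemma incl_order_simps [simp]:
  "carrier (incl_order \<A>) = \<A>" "eq (incl_order \<A>) = (=)" "le (incl_order \<A>) = (\<subseteq>)"
  by (simp_all add: incl_order_def)

lemma partial_order_incl_order: "partial_order (incl_order \<A>)"
  by unfold_locales auto

lemma arrows_in_Tr: "arrows \<in> Tr"
  by (auto simp: Tr_def transfer_system_def order_on_defs arrows_def
      intro!: refl_onI transI antisymI)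

lemma Inter_in_Tr:
  assumes "\<S> \<subseteq> Tr"
  shows "arrows \<inter> \<Inter>\<S> \<in> Tr"
proof -
  have ts: "transfer_system R" if "R \<in> insert arrows \<S>" for R
    using that assms arrows_in_Tr by (auto simp: Tr_def)
  have po: "partial_order_on UNIV R" if "R \<in> insert arrows \<S>" for R
    using ts[OF that] by (simp add: transfer_system_def)
  have pb: "(Lattices.inf x z, z) \<in> R"
    if "R \<in> insert arrows \<S>" "(x, y) \<in> R" "z \<le> y" for R x y z
    using ts[OF that(1)] that(2,3) unfolding transfer_system_def by blast
  have "refl (\<Inter>(insert arrows \<S>))"
    using po[THEN partial_order_onD(1)] by (auto simp: refl_on_def)
  moreover have "trans (\<Inter>(insert arrows \<S>))"
    by (rule transI) (meson InterI InterE po[THEN partial_order_onD(2)] transD)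
  moreover have "antisym (\<Inter>(insert arrows \<S>))"
    by (auto simp: arrows_def intro!: antisymI)
  ultimately have "partial_order_on UNIV (\<Inter>(insert arrows \<S>))"
    by (simp add: order_on_defs)
  moreover have "(Lattices.inf x z, z) \<in> \<Inter>(insert arrows \<S>)"
    if "(x, y) \<in> \<Inter>(insert arrows \<S>)" "z \<le> y" for x y z
    using that pb by (intro InterI) (metis InterE)
  ultimately have "transfer_system (\<Inter>(insert arrows \<S>))"
    unfolding transfer_system_def by blast
  then show ?thesis
    by (simp add: Tr_def)
qed

lemma inf_Tr:
  assumes "\<S> \<subseteq> Tr"
  shows "greatest (incl_order Tr) (arrows \<inter> \<Inter>\<S>) (Lower (incl_order Tr) \<S>)"
    and "\<Sqinter>\<^bsub>incl_order Tr\<^esub> \<S> = arrows \<inter> \<Inter>\<S>"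
proof -
  have sub: "U \<subseteq> arrows" if "U \<in> Tr" for U
    using that by (simp add: Tr_def transfer_system_def)
  show *: "greatest (incl_order Tr) (arrows \<inter> \<Inter>\<S>) (Lower (incl_order Tr) \<S>)"
    unfolding greatest_def
  proof (intro conjI ballI)
    show "Lower (incl_order Tr) \<S> \<subseteq> carrier (incl_order Tr)"
      by (auto simp: Lower_def)
    show "arrows \<inter> \<Inter>\<S> \<in> Lower (incl_order Tr) \<S>"
      using Inter_in_Tr[OF assms] by (auto simp: Lower_def)
    fix U assume "U \<in> Lower (incl_order Tr) \<S>"
    then have "U \<in> Tr" "\<forall>S\<in>\<S>. U \<subseteq> S"
      using assms by (auto simp: Lower_def)
    then have "U \<subseteq> arrows \<inter> \<Inter>\<S>"
      using sub by (intro Int_greatest Inter_greatest) auto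
    then show "U \<sqsubseteq>\<^bsub>incl_order Tr\<^esub> arrows \<inter> \<Inter>\<S>"
      by simp
  qed
  show "\<Sqinter>\<^bsub>incl_order Tr\<^esub> \<S> = arrows \<inter> \<Inter>\<S>"
    unfolding Lattice.inf_def
    by (rule partial_order.greatest_unique[OF partial_order_incl_order])
      (rule someI[where P = "\<lambda>x. is_glb _ x _"], rule *, rule *)
qed

lemma sup_Tr:
  assumes "\<S> \<subseteq> Tr"
  shows "least (incl_order Tr) (\<Inter>{T \<in> Tr. \<Union>\<S> \<subseteq> T}) (Upper (incl_order Tr) \<S>)"
    and "\<Squnion>\<^bsub>incl_order Tr\<^esub> \<S> = \<Inter>{T \<in> Tr. \<Union>\<S> \<subseteq> T}"
proof -
  have arr: "arrows \<in> {T \<in> Tr. \<Union>\<S> \<subseteq> T}"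
    using assms arrows_in_Tr by (auto simp: Tr_def transfer_system_def)
  have "arrows \<inter> \<Inter>{T \<in> Tr. \<Union>\<S> \<subseteq> T} \<in> Tr"
    by (rule Inter_in_Tr) auto
  moreover have "arrows \<inter> \<Inter>{T \<in> Tr. \<Union>\<S> \<subseteq> T} = \<Inter>{T \<in> Tr. \<Union>\<S> \<subseteq> T}"
    using arr by blast
  ultimately have mem: "\<Inter>{T \<in> Tr. \<Union>\<S> \<subseteq> T} \<in> Tr"
    by simp
  show *: "least (incl_order Tr) (\<Inter>{T \<in> Tr. \<Union>\<S> \<subseteq> T}) (Upper (incl_order Tr) \<S>)"
    unfolding least_def
  proof (intro conjI ballI)
    show "Upper (incl_order Tr) \<S> \<subseteq> carrier (incl_order Tr)"
      by (auto simp: Upper_def)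
    show "\<Inter>{T \<in> Tr. \<Union>\<S> \<subseteq> T} \<in> Upper (incl_order Tr) \<S>"
      using mem by (auto simp: Upper_def)
    fix U assume "U \<in> Upper (incl_order Tr) \<S>"
    then have "U \<in> {T \<in> Tr. \<Union>\<S> \<subseteq> T}"
      using assms by (auto simp: Upper_def)
    then show "\<Inter>{T \<in> Tr. \<Union>\<S> \<subseteq> T} \<sqsubseteq>\<^bsub>incl_order Tr\<^esub> U"
      by auto
  qed
  show "\<Squnion>\<^bsub>incl_order Tr\<^esub> \<S> = \<Inter>{T \<in> Tr. \<Union>\<S> \<subseteq> T}"
    unfolding Lattice.sup_def
    by (rule partial_order.least_unique[OF partial_order_incl_order])
      (rule someI[where P = "\<lambda>x. is_lub _ x _"], rule *, rule *)
qed

lemma complete_lattice_Tr: "complete_lattice (incl_order Tr)"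
  by (rule partial_order.complete_latticeI[OF partial_order_incl_order])
    (auto intro: inf_Tr(1) sup_Tr(1))

end

theory Submission
  imports Defs
begin

text \<open>
  The proof turns membership of a transfer system in \<open>AF_set W\<close> into a condition on its left class
  alone. In a model structure with weak equivalences \<open>W\<close> and acyclic fibrations \<open>T\<close>, the
  cofibrations must be \<open>llp T\<close> and the acyclic cofibrations must be \<open>llp T \<inter> W\<close>. Conversely, \<open>llp T\<close>
  and \<open>T\<close> always form a weak factorization system, decomposability of \<open>W\<close> makes this factorization
  restrict to \<open>W\<close> and yields two-out-of-three, and a reflexive transitive class of arrows is the
  left class of a weak factorization system as soon as it is closed under pushouts. So a transfer
  system \<open>T \<subseteq> W\<close> belongs to \<open>AF_set W\<close> iff \<open>llp T \<inter> W\<close> is closed under pushouts, that is, iff every arrow of \<open>llp T \<inter> W\<close> has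
  all its pushouts in \<open>W\<close> (lemma \<open>AF_set_iff\<close>).

  Since \<open>llp\<close> is antitone, this condition passes from \<open>T\<close> to every larger transfer system inside
  \<open>W\<close>. Among the transfer systems inside \<open>W\<close> there is a largest one, consisting of the arrows all of
  whose pullbacks lie in \<open>W\<close>; therefore joins of members stay inside \<open>W\<close> and are members.

  The condition also survives intersections of members (lemma \<open>Inter_in_AF_set\<close>). Let \<open>a \<rightarrow> b\<close>
  be an arrow of \<open>W\<close> that lifts against the intersection. Factoring with respect to one member after
  another splits off from the front arrows with all pushouts in \<open>W\<close>. By finiteness this ends at some
  \<open>e\<close>, and then \<open>e \<rightarrow> b\<close> lies in every member. Now \<open>a \<rightarrow> b\<close> lifts against \<open>e \<rightarrow> b\<close>, so \<open>e = b\<close>, and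
  all of \<open>a \<rightarrow> b\<close> has been split off.

  Hence the meet of all members is itself a member, their join is contained in \<open>W\<close>, and upward
  closure identifies \<open>AF_set W\<close> with the interval between them.
\<close>

section \<open>Weak factorization systems on a finite lattice\<close>

lemma llp_iff:
  "(a, b) \<in> llp R \<longleftrightarrow> a \<le> b \<and> (\<forall>x y. (x, y) \<in> R \<and> a \<le> x \<and> b \<le> y \<longrightarrow> b \<le> x)"
  unfolding llp_def has_lifting_def arrows_def by fastforce

lemma rlp_iff:
  "(x, y) \<in> rlp L \<longleftrightarrow> x \<le> y \<and> (\<forall>a b. (a, b) \<in> L \<and> a \<le> x \<and> b \<le> y \<longrightarrow> b \<le> x)"
  unfolding rlp_def has_lifting_def arrows_def by fastforce

lemma llp_antimono: "R \<subseteq> S \<Longrightarrow> llp S \<subseteq> llp R"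
  by (auto simp: llp_def)

lemma rlp_subset_arrows: "rlp L \<subseteq> arrows"
  by (auto simp: rlp_def)

lemma refl_llp: "refl (llp R)"
  by (auto simp: refl_on_def llp_iff)

lemma trans_llp:
  fixes R :: "'a::order rel"
  assumes "R \<subseteq> arrows"
  shows "trans (llp R)"
proof (rule transI)
  fix a b c :: 'a
  assume ab: "(a, b) \<in> llp R" and bc: "(b, c) \<in> llp R"
  show "(a, c) \<in> llp R"
    unfolding llp_iff
  proof (intro conjI allI impI)
    show "a \<le> c"
      using ab bc by (auto simp: llp_iff)
    fix x y
    assume xy: "(x, y) \<in> R \<and> a \<le> x \<and> c \<le> y"
    moreover from this bc have "b \<le> y"
      by (meson llp_iff order_trans)
    ultimately have "b \<le> x"
      using ab by (auto simp: llp_iff)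
    with xy bc show "c \<le> x"
      by (auto simp: llp_iff)
  qed
qed

lemma llp_pushout:
  fixes R :: "'a::lattice rel"
  assumes R: "R \<subseteq> arrows" and ab: "(a, b) \<in> llp R" and "a \<le> c"
  shows "(c, Lattices.sup b c) \<in> llp R"
  unfolding llp_iff
proof (intro conjI allI impI)
  show "c \<le> Lattices.sup b c"
    by simp
  fix x y
  assume xy: "(x, y) \<in> R \<and> c \<le> x \<and> Lattices.sup b c \<le> y"
  then have "a \<le> x" "b \<le> y"
    using \<open>a \<le> c\<close> by auto
  with xy ab have "b \<le> x"
    by (auto simp: llp_iff)
  with xy show "Lattices.sup b c \<le> x"
    by simp
qed

lemma transfer_systemD:
  assumes "transfer_system R"
  shows "R \<subseteq> arrows" "refl R" "trans R"
    and "\<And>x y z. (x, y) \<in> R \<Longrightarrow> z \<le> y \<Longrightarrow> (Lattices.inf x z, z) \<in> R"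
  using assms unfolding transfer_system_def order_on_defs by auto

lemma rlp_transfer_system:
  fixes L :: "'a::{finite, lattice} rel"
  shows "transfer_system (rlp L)"
proof -
  have "refl (rlp L)" "antisym (rlp L)"
    by (auto simp: refl_on_def antisym_def rlp_iff intro: antisym)
  moreover have "trans (rlp L)"
  proof (rule transI)
    fix x y z
    assume xy: "(x, y) \<in> rlp L" and yz: "(y, z) \<in> rlp L"
    have "b \<le> x" if "(a, b) \<in> L" "a \<le> x" "b \<le> z" for a b
    proof -
      have "a \<le> y"
        using \<open>a \<le> x\<close> xy by (auto simp: rlp_iff)
      then have "b \<le> y"
        using that yz by (auto simp: rlp_iff)
      then show ?thesis
        using that xy by (auto simp: rlp_iff)
    qed
    moreover have "x \<le> z"
      using xy yz by (auto simp: rlp_iff)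
    ultimately show "(x, z) \<in> rlp L"
      by (auto simp: rlp_iff)
  qed
  moreover have "(Lattices.inf x z, z) \<in> rlp L" if xy: "(x, y) \<in> rlp L" and "z \<le> y" for x y z
  proof -
    have "b \<le> x" if "(a, b) \<in> L" "a \<le> x" "b \<le> z" for a b
    proof -
      have "b \<le> y"
        using \<open>b \<le> z\<close> \<open>z \<le> y\<close> by (rule order_trans)
      then show ?thesis
        using that xy by (auto simp: rlp_iff)
    qed
    then show ?thesis
      by (auto simp: rlp_iff)
  qed
  moreover have "rlp L \<subseteq> arrows"
    by (auto simp: rlp_iff arrows_def)
  ultimately show ?thesis
    unfolding transfer_system_def order_on_defs by auto
qed

text \<open>
  The middle object of the factorization of \<open>a \<rightarrow> b\<close> is a minimal \<open>c \<ge> a\<close> with \<open>c \<rightarrow> b\<close> in \<open>R\<close>. A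
  square from \<open>a \<rightarrow> c\<close> to an arrow \<open>x \<rightarrow> y\<close> of \<open>R\<close> has a lift because \<open>x \<sqinter> c\<close> competes with \<open>c\<close>.
\<close>

lemma transfer_system_factorization:
  fixes R :: "'a::{finite, lattice} rel"
  assumes R: "transfer_system R" and "a \<le> b"
  obtains c where "(a, c) \<in> llp R" "(c, b) \<in> R"
proof -
  note R = transfer_systemD[OF R]
  let ?A = "{c. a \<le> c \<and> (c, b) \<in> R}"
  have "b \<in> ?A"
    using R(2) \<open>a \<le> b\<close> by (auto simp: refl_on_def)
  then obtain c where c: "c \<in> ?A" and minimal: "\<And>d. d \<in> ?A \<Longrightarrow> d \<le> c \<Longrightarrow> c = d"
    using finite_has_minimal[of ?A] by auto
  have "(a, c) \<in> llp R"
    unfolding llp_iff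
  proof (intro conjI allI impI)
    show "a \<le> c"
      using c by simp
    fix x y
    assume xy: "(x, y) \<in> R \<and> a \<le> x \<and> c \<le> y"
    then have "(Lattices.inf x c, c) \<in> R"
      using R(4) by blast
    with c have "(Lattices.inf x c, b) \<in> R"
      using R(3) by (auto dest: transD)
    with xy c have "c = Lattices.inf x c"
      by (intro minimal) auto
    then show "c \<le> x"
      by (metis inf_le1)
  qed
  with c that show thesis
    by blast
qed

lemma transfer_system_wfs:
  fixes R :: "'a::{finite, lattice} rel"
  assumes "transfer_system R"
  shows "weak_factorization_system (llp R) R"
proof -
  have "arrows \<subseteq> llp R O R"
  proof
    fix f :: "'a \<times> 'a"
    assume "f \<in> arrows"
    then obtain a b where [simp]: "f = (a, b)" and "a \<le> b"
      by (auto simp: arrows_def)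
    then obtain c where "(a, c) \<in> llp R" "(c, b) \<in> R"
      using transfer_system_factorization[OF assms] by blast
    then show "f \<in> llp R O R"
      by auto
  qed
  moreover have "R \<subseteq> rlp (llp R)"
    using transfer_systemD(1)[OF assms] by (force simp: llp_def rlp_def)
  moreover have "rlp (llp R) \<subseteq> R"
  proof
    fix p
    assume p: "p \<in> rlp (llp R)"
    obtain x y where [simp]: "p = (x, y)"
      by fastforce
    obtain c where c: "(x, c) \<in> llp R" "(c, y) \<in> R"
      using transfer_system_factorization[OF assms] p by (auto simp: rlp_iff)
    then have "c \<le> y"
      using transfer_systemD(1)[OF assms] by (auto simp: arrows_def)
    with c p have "c \<le> x"
      by (auto simp: rlp_iff)
    with c have "c = x"
      by (simp add: llp_iff)
    with c show "p \<in> R"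
      by simp
  qed
  ultimately show ?thesis
    unfolding weak_factorization_system_def by blast
qed

text \<open>
  Dually, the middle object is a maximal \<open>c \<le> b\<close> with \<open>a \<rightarrow> c\<close> in \<open>L\<close>, and for \<open>x \<rightarrow> y\<close> in \<open>L\<close> the
  competitor of \<open>c\<close> is \<open>y \<squnion> c\<close>.
\<close>

lemma pushout_closed_factorization:
  fixes L :: "'a::{finite, lattice} rel"
  assumes "refl L" "trans L"
    and pushout: "\<And>a b c. (a, b) \<in> L \<Longrightarrow> a \<le> c \<Longrightarrow> (c, Lattices.sup b c) \<in> L"
    and "a \<le> b"
  obtains c where "(a, c) \<in> L" "(c, b) \<in> rlp L"
proof -
  let ?A = "{c. c \<le> b \<and> (a, c) \<in> L}"
  have "a \<in> ?A"
    using \<open>refl L\<close> \<open>a \<le> b\<close> by (auto simp: refl_on_def)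
  then obtain c where c: "c \<in> ?A" and maximal: "\<And>d. d \<in> ?A \<Longrightarrow> c \<le> d \<Longrightarrow> c = d"
    using finite_has_maximal[of ?A] by auto
  have "(c, b) \<in> rlp L"
    unfolding rlp_iff
  proof (intro conjI allI impI)
    show "c \<le> b"
      using c by simp
    fix x y
    assume xy: "(x, y) \<in> L \<and> x \<le> c \<and> y \<le> b"
    then have "(c, Lattices.sup y c) \<in> L"
      using pushout by blast
    with c have "(a, Lattices.sup y c) \<in> L"
      using \<open>trans L\<close> by (auto dest: transD)
    with xy c have "c = Lattices.sup y c"
      by (intro maximal) auto
    then show "y \<le> c"
      by (metis sup_ge1)
  qed
  with c that show thesis
    by blast
qed

lemma pushout_closed_wfs:
  fixes L :: "'a::{finite, lattice} rel"
  assumes "L \<subseteq> arrows" "refl L" "trans L"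
    and pushout: "\<And>a b c. (a, b) \<in> L \<Longrightarrow> a \<le> c \<Longrightarrow> (c, Lattices.sup b c) \<in> L"
  shows "weak_factorization_system L (rlp L)"
proof -
  have factorization: "\<exists>c. (a, c) \<in> L \<and> (c, b) \<in> rlp L" if "a \<le> b" for a b
    by (rule pushout_closed_factorization[OF assms(2,3) _ that]) (use pushout in blast)+
  have "arrows \<subseteq> L O rlp L"
  proof
    fix f :: "'a \<times> 'a"
    assume "f \<in> arrows"
    then obtain a b where [simp]: "f = (a, b)" and "a \<le> b"
      by (auto simp: arrows_def)
    then obtain c where "(a, c) \<in> L" "(c, b) \<in> rlp L"
      using factorization by blast
    then show "f \<in> L O rlp L"
      by auto
  qed
  moreover have "L \<subseteq> llp (rlp L)"
    using \<open>L \<subseteq> arrows\<close> by (force simp: llp_def rlp_def)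
  moreover have "llp (rlp L) \<subseteq> L"
  proof
    fix i
    assume i: "i \<in> llp (rlp L)"
    obtain a b where [simp]: "i = (a, b)"
      by fastforce
    obtain c where c: "(a, c) \<in> L" "(c, b) \<in> rlp L"
      using i by (auto simp: llp_iff dest: factorization)
    then have "a \<le> c"
      using \<open>L \<subseteq> arrows\<close> by (auto simp: arrows_def)
    with c i have "b \<le> c"
      by (auto simp: llp_iff)
    with c have "c = b"
      by (simp add: rlp_iff)
    with c show "i \<in> L"
      by simp
  qed
  ultimately show ?thesis
    unfolding weak_factorization_system_def by blast
qed

section \<open>Acyclic fibrations with prescribed weak equivalences\<close>

lemma wide_subcategoryD:
  assumes "wide_subcategory W"
  shows "W \<subseteq> arrows" "refl W" "trans W"
  using assms unfolding wide_subcategory_def by auto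

lemma decomposableD:
  assumes "decomposable W" "a \<le> b" "b \<le> c" "(a, c) \<in> W"
  shows "(a, b) \<in> W" "(b, c) \<in> W"
  using assms unfolding decomposable_def arrows_def by blast+

lemma two_out_of_three_decomposable:
  assumes "wide_subcategory W" "decomposable W"
  shows "two_out_of_three W"
  using wide_subcategoryD(3)[OF assms(1)] assms(2)
  unfolding two_out_of_three_def decomposable_def by (meson transD)

definition pushouts_in :: "'a::lattice rel \<Rightarrow> 'a rel" where
  "pushouts_in W = {(a, b). a \<le> b \<and> (\<forall>c\<ge>a. (c, Lattices.sup b c) \<in> W)}"

definition pullbacks_in :: "'a::lattice rel \<Rightarrow> 'a rel" where
  "pullbacks_in W = {(x, y). x \<le> y \<and> (\<forall>z\<le>y. (Lattices.inf x z, z) \<in> W)}"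

text \<open>
  The pushout of a composite is the composite of a pushout of the first arrow and a pushout of the
  second, and likewise for pullbacks.
\<close>

lemma trans_pushouts_in:
  fixes W :: "'a::lattice rel"
  assumes "trans W"
  shows "trans (pushouts_in W)"
proof (rule transI)
  fix a b d :: 'a
  assume ab: "(a, b) \<in> pushouts_in W" and bd: "(b, d) \<in> pushouts_in W"
  have "(c, Lattices.sup d c) \<in> W" if "a \<le> c" for c
  proof -
    have "(c, Lattices.sup b c) \<in> W"
      using ab that by (simp add: pushouts_in_def)
    moreover have "(Lattices.sup b c, Lattices.sup d (Lattices.sup b c)) \<in> W"
      using bd by (simp add: pushouts_in_def)
    moreover have "Lattices.sup d (Lattices.sup b c) = Lattices.sup d c"
      using bd by (simp add: pushouts_in_def sup_absorb1 flip: sup_assoc)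
    ultimately show ?thesis
      using assms by (auto dest: transD)
  qed
  then show "(a, d) \<in> pushouts_in W"
    using ab bd by (auto simp: pushouts_in_def)
qed

lemma pullbacks_in_subset: "pullbacks_in W \<subseteq> W"
  by (auto simp: pullbacks_in_def) (metis inf_absorb1 order_refl)

lemma pullbacks_in_Tr:
  fixes W :: "'a::{finite, lattice} rel"
  assumes "refl W" "trans W"
  shows "pullbacks_in W \<in> Tr"
proof -
  have "refl (pullbacks_in W)"
    using \<open>refl W\<close> by (auto simp: refl_on_def pullbacks_in_def inf_absorb2)
  moreover have "antisym (pullbacks_in W)"
    by (auto simp: antisym_def pullbacks_in_def)
  moreover have "trans (pullbacks_in W)"
  proof (rule transI)
    fix x y t :: 'a
    assume xy: "(x, y) \<in> pullbacks_in W" and yt: "(y, t) \<in> pullbacks_in W"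
    have "(Lattices.inf x z, z) \<in> W" if "z \<le> t" for z
    proof -
      have "(Lattices.inf y z, z) \<in> W"
        using yt that by (simp add: pullbacks_in_def)
      moreover have "(Lattices.inf x (Lattices.inf y z), Lattices.inf y z) \<in> W"
        using xy by (simp add: pullbacks_in_def)
      moreover have "Lattices.inf x (Lattices.inf y z) = Lattices.inf x z"
        using xy by (simp add: pullbacks_in_def inf_absorb1 flip: inf_assoc)
      ultimately show ?thesis
        using \<open>trans W\<close> by (auto dest: transD)
    qed
    then show "(x, t) \<in> pullbacks_in W"
      using xy yt by (auto simp: pullbacks_in_def)
  qed
  moreover have "(Lattices.inf x z, z) \<in> pullbacks_in W"
    if "(x, y) \<in> pullbacks_in W" "z \<le> y" for x y z
  proof -
    have "(Lattices.inf (Lattices.inf x z) u, u) \<in> W" if "u \<le> z" for u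
    proof -
      have "(Lattices.inf x u, u) \<in> W"
        using \<open>(x, y) \<in> pullbacks_in W\<close> \<open>z \<le> y\<close> that by (auto simp: pullbacks_in_def)
      then show ?thesis
        using that by (simp add: inf_assoc inf_absorb2)
    qed
    then show ?thesis
      by (auto simp: pullbacks_in_def)
  qed
  moreover have "pullbacks_in W \<subseteq> arrows"
    by (auto simp: pullbacks_in_def arrows_def)
  ultimately show ?thesis
    unfolding Tr_def transfer_system_def order_on_defs by auto
qed

lemma transfer_system_subset_pullbacks_in:
  assumes "transfer_system T" "T \<subseteq> W"
  shows "T \<subseteq> pullbacks_in W"
  using transfer_systemD(1,4)[OF assms(1)] assms(2)
  by (fastforce simp: pullbacks_in_def arrows_def)

lemma model_structureD:
  assumes "model_structure AC F C AF"
  shows "AC = llp F" "F = rlp AC" "C = llp AF" "AF = rlp C" "AC \<subseteq> C"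
  using assms unfolding model_structure_def weak_factorization_system_def by blast+

text \<open>
  The retract argument: let a cofibration \<open>a \<rightarrow> b\<close> be an acyclic cofibration \<open>a \<rightarrow> m\<close> followed by an
  acyclic fibration \<open>m \<rightarrow> b\<close>. It lifts against \<open>m \<rightarrow> b\<close>, which in a poset forces \<open>m = b\<close>, so it is
  an acyclic cofibration itself.
\<close>

lemma acyclic_cofibrations_eq:
  fixes AC :: "'a::order rel"
  assumes "model_structure AC F C AF"
  shows "AC = llp AF \<inter> (AC O AF)"
proof
  note model = model_structureD[OF assms]
  have "refl AF"
    unfolding model(4) by (auto simp: rlp_iff refl_on_def)
  then show "AC \<subseteq> llp AF \<inter> (AC O AF)"
    using model(3,5) by (auto simp: refl_on_def)
  show "llp AF \<inter> (AC O AF) \<subseteq> AC"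
  proof
    fix i
    assume "i \<in> llp AF \<inter> (AC O AF)"
    then obtain a b m where i: "i = (a, b)" "(a, b) \<in> llp AF" "(a, m) \<in> AC" "(m, b) \<in> AF"
      by blast
    have "AC \<subseteq> arrows" "AF \<subseteq> arrows"
      unfolding model(1) model(4) by (auto simp: llp_def rlp_def)
    with i have "a \<le> m" "m \<le> b"
      by (auto simp: arrows_def)
    with i have "m = b"
      by (auto simp: llp_iff intro: antisym)
    with i show "i \<in> AC"
      by simp
  qed
qed

text \<open>
  The acyclic cofibrations can only be \<open>llp T \<inter> W\<close>, so everything hinges on this class being a left
  class. Pushouts of its arrows remain in \<open>llp T\<close>, hence only their membership in \<open>W\<close> is at stake.
\<close>

lemma AF_set_iff:
  fixes W :: "'a::{finite, lattice} rel"
  assumes W: "wide_subcategory W" "decomposable W"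
  shows "T \<in> AF_set W \<longleftrightarrow> T \<in> Tr \<and> T \<subseteq> W \<and> llp T \<inter> W \<subseteq> pushouts_in W"
proof
  assume "T \<in> AF_set W"
  then obtain AC F C where T: "T \<in> Tr" "T \<subseteq> W"
    and model: "model_structure AC F C T" and "W = AC O T"
    by (auto simp: AF_set_def)
  then have AC: "AC = llp T \<inter> W"
    using acyclic_cofibrations_eq by blast
  have F: "AC = llp F" "F \<subseteq> arrows"
    using model_structureD(1,2)[OF model] rlp_subset_arrows by blast+
  have "llp T \<inter> W \<subseteq> pushouts_in W"
  proof
    fix i
    assume "i \<in> llp T \<inter> W"
    then obtain a b where i: "i = (a, b)" "(a, b) \<in> llp F"
      using AC F by (metis surj_pair)
    then have "(c, Lattices.sup b c) \<in> W" if "a \<le> c" for c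
      using llp_pushout[OF F(2) _ that] AC F by blast
    with i show "i \<in> pushouts_in W"
      by (auto simp: pushouts_in_def llp_iff)
  qed
  with T show "T \<in> Tr \<and> T \<subseteq> W \<and> llp T \<inter> W \<subseteq> pushouts_in W"
    by simp
next
  assume T: "T \<in> Tr \<and> T \<subseteq> W \<and> llp T \<inter> W \<subseteq> pushouts_in W"
  then have ts: "transfer_system T"
    by (simp add: Tr_def)
  note W' = wide_subcategoryD[OF W(1)]
  let ?L = "llp T \<inter> W"
  have "weak_factorization_system ?L (rlp ?L)"
  proof (rule pushout_closed_wfs)
    show "?L \<subseteq> arrows"
      using W'(1) by blast
    show "refl ?L"
      using W'(2) refl_llp[of T] by (auto simp: refl_on_def)
    show "trans ?L"
      using W'(3) trans_llp[OF transfer_systemD(1)[OF ts]] by (rule trans_Int[rotated])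
    show "(c, Lattices.sup b c) \<in> ?L" if "(a, b) \<in> ?L" "a \<le> c" for a b c
      using that T llp_pushout[OF transfer_systemD(1)[OF ts]] by (auto simp: pushouts_in_def)
  qed
  moreover have "W = ?L O T"
  proof
    show "W \<subseteq> ?L O T"
    proof
      fix f
      assume f: "f \<in> W"
      then obtain a b where [simp]: "f = (a, b)" and "a \<le> b"
        using W'(1) by (auto simp: arrows_def)
      then obtain c where c: "(a, c) \<in> llp T" "(c, b) \<in> T"
        using transfer_system_factorization[OF ts] by blast
      then have "a \<le> c" "c \<le> b"
        using transfer_systemD(1)[OF ts] by (auto simp: llp_iff arrows_def)
      then have "(a, c) \<in> W"
        using decomposableD(1)[OF W(2)] f by simp
      with c show "f \<in> ?L O T"
        by auto
    qed
    show "?L O T \<subseteq> W"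
      using T W'(3) by (auto dest: transD)
  qed
  moreover have "two_out_of_three W"
    using two_out_of_three_decomposable[OF W] .
  ultimately have "model_structure ?L (rlp ?L) (llp T) T" "W = ?L O T"
    using transfer_system_wfs[OF ts] unfolding model_structure_def by auto
  with T show "T \<in> AF_set W"
    unfolding AF_set_def by blast
qed

lemma AF_set_upward_closed:
  fixes W :: "'a::{finite, lattice} rel"
  assumes W: "wide_subcategory W" "decomposable W"
    and "S \<in> AF_set W" "T \<in> Tr" "S \<subseteq> T" "T \<subseteq> W"
  shows "T \<in> AF_set W"
  using assms(3-6) llp_antimono[OF \<open>S \<subseteq> T\<close>] unfolding AF_set_iff[OF W] by blast

lemma AF_set_subset_Tr: "AF_set W \<subseteq> Tr"
  by (auto simp: AF_set_def)

text \<open>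
  The acyclic fibrations of a model structure are a right lifting class, hence automatically a
  transfer system.
\<close>

lemma AF_set_nonempty:
  assumes "weak_equivalence_set W"
  shows "AF_set W \<noteq> {}"
proof -
  obtain AC F C T where model: "model_structure AC F C T" "W = AC O T"
    using assms by (auto simp: weak_equivalence_set_def)
  then have "AC = llp F" "T = rlp C"
    using model_structureD(1,4) by blast+
  then have "T \<in> Tr" "T \<subseteq> W"
    using rlp_transfer_system[of C] refl_llp[of F] model(2)
    by (auto simp: Tr_def refl_on_def)
  with model show ?thesis
    unfolding AF_set_def by blast
qed

section \<open>Meets and joins of acyclic fibrations\<close>

text \<open>
  Let \<open>a \<rightarrow> b\<close> be in \<open>W\<close> and in the left class of the intersection. Take a maximal \<open>e \<le> b\<close> such that
  \<open>a \<rightarrow> e\<close> has all pushouts in \<open>W\<close>. For each member \<open>T\<close>, the left factor of \<open>e \<rightarrow> b\<close> with respect to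
  \<open>T\<close> has all pushouts in \<open>W\<close> as well, so it is trivial by maximality, and \<open>e \<rightarrow> b\<close> lies in \<open>T\<close>.
  Lifting against \<open>e \<rightarrow> b\<close> then gives \<open>e = b\<close>.
\<close>

lemma Inter_in_AF_set:
  fixes W :: "'a::{finite, lattice} rel"
  assumes W: "wide_subcategory W" "decomposable W"
    and \<S>: "\<S> \<subseteq> AF_set W" "\<S> \<noteq> {}"
  shows "arrows \<inter> \<Inter>\<S> \<in> AF_set W"
proof -
  let ?I = "arrows \<inter> \<Inter>\<S>"
  note W' = wide_subcategoryD[OF W(1)]
  have member: "transfer_system T" "T \<subseteq> W" "llp T \<inter> W \<subseteq> pushouts_in W" if "T \<in> \<S>" for T
    using that \<S>(1) AF_set_iff[OF W] by (auto simp: Tr_def)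
  have "?I \<in> Tr"
    using \<S>(1) AF_set_subset_Tr by (intro Inter_in_Tr) blast
  moreover have "?I \<subseteq> W"
    using \<S>(2) member(2) by blast
  moreover have "llp ?I \<inter> W \<subseteq> pushouts_in W"
  proof
    fix i
    assume i: "i \<in> llp ?I \<inter> W"
    obtain a b where [simp]: "i = (a, b)"
      by fastforce
    from i have "a \<le> b"
      by (simp add: llp_iff)
    let ?A = "{e. e \<le> b \<and> (a, e) \<in> pushouts_in W}"
    have "a \<in> ?A"
      using W'(2) \<open>a \<le> b\<close> by (auto simp: pushouts_in_def refl_on_def sup_absorb2)
    then obtain e where e: "e \<in> ?A" and maximal: "\<And>d. d \<in> ?A \<Longrightarrow> e \<le> d \<Longrightarrow> e = d"
      using finite_has_maximal[of ?A] by auto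
    then have "a \<le> e" "e \<le> b"
      by (auto simp: pushouts_in_def)
    then have eb: "(e, b) \<in> W"
      using decomposableD(2)[OF W(2)] i by simp
    have "(e, b) \<in> T" if T: "T \<in> \<S>" for T
    proof -
      obtain d where d: "(e, d) \<in> llp T" "(d, b) \<in> T"
        using transfer_system_factorization[OF member(1)[OF T] \<open>e \<le> b\<close>] .
      then have ed: "e \<le> d" "d \<le> b"
        using transfer_systemD(1)[OF member(1)[OF T]] by (auto simp: llp_iff arrows_def)
      then have "(e, d) \<in> W"
        using decomposableD(1)[OF W(2) _ _ eb] by simp
      with d have "(e, d) \<in> pushouts_in W"
        using member(3)[OF T] by blast
      with e have "(a, d) \<in> pushouts_in W"
        using trans_pushouts_in[OF W'(3)] by (auto dest: transD)
      with ed have "e = d"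
        by (intro maximal) auto
      with d show ?thesis
        by simp
    qed
    then have "(e, b) \<in> ?I"
      using \<open>e \<le> b\<close> by (auto simp: arrows_def)
    with i \<open>a \<le> e\<close> have "b \<le> e"
      unfolding \<open>i = (a, b)\<close> Int_iff[of _ "llp _"] llp_iff by blast
    with \<open>e \<le> b\<close> e show "i \<in> pushouts_in W"
      by auto
  qed
  ultimately show ?thesis
    using AF_set_iff[OF W] by blast
qed

text \<open>
  The join is the least upper bound, and \<open>pullbacks_in W\<close> is a transfer system that bounds all
  members and still lies inside \<open>W\<close>.
\<close>

lemma join_subset_W:
  fixes W :: "'a::{finite, lattice} rel"
  assumes W: "wide_subcategory W" and "\<S> \<subseteq> AF_set W"
  shows "\<Inter>{T \<in> Tr. \<Union>\<S> \<subseteq> T} \<subseteq> W"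
proof -
  have "T \<subseteq> pullbacks_in W" if "T \<in> \<S>" for T
  proof (rule transfer_system_subset_pullbacks_in)
    show "transfer_system T" "T \<subseteq> W"
      using that \<open>\<S> \<subseteq> AF_set W\<close> unfolding AF_set_def Tr_def by blast+
  qed
  then have "pullbacks_in W \<in> {T \<in> Tr. \<Union>\<S> \<subseteq> T}"
    using pullbacks_in_Tr[OF wide_subcategoryD(2,3)[OF W]] by auto
  then show ?thesis
    using pullbacks_in_subset[of W] by blast
qed

lemma join_in_AF_set:
  fixes W :: "'a::{finite, lattice} rel"
  assumes W: "wide_subcategory W" "decomposable W"
    and \<S>: "\<S> \<subseteq> AF_set W" "\<S> \<noteq> {}"
  shows "\<Inter>{T \<in> Tr. \<Union>\<S> \<subseteq> T} \<in> AF_set W"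
proof -
  let ?J = "\<Inter>{T \<in> Tr. \<Union>\<S> \<subseteq> T}"
  obtain S where "S \<in> \<S>"
    using \<S>(2) by blast
  have "\<S> \<subseteq> Tr"
    using \<S>(1) AF_set_subset_Tr by blast
  then have "?J \<in> Tr"
    using sup_Tr(1)[of \<S>] by (auto simp: least_def Upper_def)
  moreover have "S \<in> AF_set W" "S \<subseteq> ?J"
    using \<open>S \<in> \<S>\<close> \<S>(1) by blast+
  ultimately show ?thesis
    using AF_set_upward_closed[OF W] join_subset_W[OF W(1) \<S>(1)] by blast
qed

lemma greatest_incl_order_iff:
  assumes "\<S> \<subseteq> \<A>"
  shows "greatest (incl_order \<A>) m (Lower (incl_order \<A>) \<S>) \<longleftrightarrow>
    m \<in> \<A> \<and> (\<forall>S\<in>\<S>. m \<subseteq> S) \<and> (\<forall>U\<in>\<A>. (\<forall>S\<in>\<S>. U \<subseteq> S) \<longrightarrow> U \<subseteq> m)"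
proof -
  have "Lower (incl_order \<A>) \<S> = {U \<in> \<A>. \<forall>S\<in>\<S>. U \<subseteq> S}"
    unfolding Lower_def incl_order_simps Int_absorb2[OF assms] Ball_def
    by (intro equalityI subsetI) simp_all
  then show ?thesis
    unfolding greatest_def incl_order_simps by simp blast
qed

lemma least_incl_order_iff:
  assumes "\<S> \<subseteq> \<A>"
  shows "least (incl_order \<A>) m (Upper (incl_order \<A>) \<S>) \<longleftrightarrow>
    m \<in> \<A> \<and> (\<forall>S\<in>\<S>. S \<subseteq> m) \<and> (\<forall>U\<in>\<A>. (\<forall>S\<in>\<S>. S \<subseteq> U) \<longrightarrow> m \<subseteq> U)"
proof -
  have "Upper (incl_order \<A>) \<S> = {U \<in> \<A>. \<forall>S\<in>\<S>. S \<subseteq> U}"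
    unfolding Upper_def incl_order_simps Int_absorb2[OF assms] Ball_def
    by (intro equalityI subsetI) simp_all
  then show ?thesis
    unfolding least_def incl_order_simps by simp blast
qed

lemma greatest_incl_order_subset:
  assumes "greatest (incl_order \<B>) m (Lower (incl_order \<B>) \<S>)" "\<A> \<subseteq> \<B>" "m \<in> \<A>" "\<S> \<subseteq> \<A>"
  shows "greatest (incl_order \<A>) m (Lower (incl_order \<A>) \<S>)"
  using assms(1,3) subsetD[OF assms(2)]
  unfolding greatest_incl_order_iff[OF assms(4)]
    greatest_incl_order_iff[OF order_trans[OF assms(4,2)]]
  by simp

lemma least_incl_order_subset:
  assumes "least (incl_order \<B>) m (Upper (incl_order \<B>) \<S>)" "\<A> \<subseteq> \<B>" "m \<in> \<A>" "\<S> \<subseteq> \<A>"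
  shows "least (incl_order \<A>) m (Upper (incl_order \<A>) \<S>)"
  using assms(1,3) subsetD[OF assms(2)]
  unfolding least_incl_order_iff[OF assms(4)]
    least_incl_order_iff[OF order_trans[OF assms(4,2)]]
  by simp

lemma inf_incl_order_eq:
  assumes "greatest (incl_order \<A>) m (Lower (incl_order \<A>) \<S>)"
  shows "\<Sqinter>\<^bsub>incl_order \<A>\<^esub> \<S> = m"
  unfolding Lattice.inf_def
  by (rule partial_order.greatest_unique[OF partial_order_incl_order])
    (rule someI[where P = "\<lambda>x. is_glb _ x _"], rule assms, rule assms)

lemma sup_incl_order_eq:
  assumes "least (incl_order \<A>) m (Upper (incl_order \<A>) \<S>)"
  shows "\<Squnion>\<^bsub>incl_order \<A>\<^esub> \<S> = m"
  unfolding Lattice.sup_def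
  by (rule partial_order.least_unique[OF partial_order_incl_order])
    (rule someI[where P = "\<lambda>x. is_lub _ x _"], rule assms, rule assms)

theorem theorem4p20:
  fixes W :: "'a::{finite, lattice} rel"
  assumes "weak_equivalence_set W"
  shows "(lattice (incl_order (AF_set W)) \<and>
      (\<forall>S\<in>AF_set W. \<forall>T\<in>AF_set W.
        S \<sqinter>\<^bsub>incl_order (AF_set W)\<^esub> T = S \<sqinter>\<^bsub>incl_order Tr\<^esub> T \<and>
        S \<squnion>\<^bsub>incl_order (AF_set W)\<^esub> T = S \<squnion>\<^bsub>incl_order Tr\<^esub> T)) \<and>
    AF_set W = {T \<in> Tr. AF_min W \<subseteq> T \<and> T \<subseteq> AF_max W}"
proof -
  have W: "wide_subcategory W" "decomposable W"
    using assms by (auto simp: weak_equivalence_set_def)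
  have nonempty: "AF_set W \<noteq> {}"
    using AF_set_nonempty[OF assms] .
  have glb: "greatest (incl_order (AF_set W)) (arrows \<inter> \<Inter>\<S>) (Lower (incl_order (AF_set W)) \<S>)"
    if "\<S> \<subseteq> AF_set W" "\<S> \<noteq> {}" for \<S>
    using that AF_set_subset_Tr[of W]
    by (intro greatest_incl_order_subset[OF inf_Tr(1)] Inter_in_AF_set W) auto
  have lub: "least (incl_order (AF_set W)) (\<Inter>{T \<in> Tr. \<Union>\<S> \<subseteq> T})
      (Upper (incl_order (AF_set W)) \<S>)"
    if "\<S> \<subseteq> AF_set W" "\<S> \<noteq> {}" for \<S>
    using that AF_set_subset_Tr[of W]
    by (intro least_incl_order_subset[OF sup_Tr(1)] join_in_AF_set W) auto
  interpret partial_order "incl_order (AF_set W)"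
    by (rule partial_order_incl_order)
  have "lattice (incl_order (AF_set W))"
  proof
    fix S T
    assume "S \<in> carrier (incl_order (AF_set W))" "T \<in> carrier (incl_order (AF_set W))"
    then have ST: "{S, T} \<subseteq> AF_set W"
      by simp
    show "\<exists>s. least (incl_order (AF_set W)) s (Upper (incl_order (AF_set W)) {S, T})"
      using lub[OF ST] by blast
    show "\<exists>s. greatest (incl_order (AF_set W)) s (Lower (incl_order (AF_set W)) {S, T})"
      using glb[OF ST] by blast
  qed
  moreover have "S \<sqinter>\<^bsub>incl_order (AF_set W)\<^esub> T = S \<sqinter>\<^bsub>incl_order Tr\<^esub> T \<and>
      S \<squnion>\<^bsub>incl_order (AF_set W)\<^esub> T = S \<squnion>\<^bsub>incl_order Tr\<^esub> T"
    if "S \<in> AF_set W" "T \<in> AF_set W" for S T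
  proof -
    have ST: "{S, T} \<subseteq> AF_set W" "{S, T} \<subseteq> Tr"
      using that AF_set_subset_Tr by auto
    show ?thesis
      unfolding Lattice.meet_def Lattice.join_def inf_Tr(2)[OF ST(2)] sup_Tr(2)[OF ST(2)]
      using ST(1) by (intro conjI inf_incl_order_eq glb sup_incl_order_eq lub) auto
  qed
  moreover have "AF_set W = {T \<in> Tr. AF_min W \<subseteq> T \<and> T \<subseteq> AF_max W}"
  proof
    have min: "AF_min W = arrows \<inter> \<Inter>(AF_set W)"
      unfolding AF_min_def by (rule inf_Tr(2)[OF AF_set_subset_Tr])
    have max: "AF_max W = \<Inter>{T \<in> Tr. \<Union>(AF_set W) \<subseteq> T}"
      unfolding AF_max_def by (rule sup_Tr(2)[OF AF_set_subset_Tr])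
    show "AF_set W \<subseteq> {T \<in> Tr. AF_min W \<subseteq> T \<and> T \<subseteq> AF_max W}"
      unfolding min max using AF_set_subset_Tr[of W] by blast
    have "AF_min W \<in> AF_set W"
      unfolding min using nonempty by (intro Inter_in_AF_set W) auto
    moreover have "AF_max W \<subseteq> W"
      unfolding max by (rule join_subset_W[OF W(1) order_refl])
    ultimately show "{T \<in> Tr. AF_min W \<subseteq> T \<and> T \<subseteq> AF_max W} \<subseteq> AF_set W"
      by (auto intro: AF_set_upward_closed[OF W])
  qed
  ultimately show ?thesis
    by blast
qed

end
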